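(* Let $n\ge 1$ and let $\psi:\mathbb{N}\to\mathbb{R}_{\ge 0}$ be a non-negative function. Then the $n$-dimensional Lebesgue measure of each of the sets $\mathcal{S}^\times_n(\psi)$ and $\mathcal{D}^\times_n(\psi)$ is either $0$ or $1$; that is, $$|\mathcal{S}^\times_n(\psi)|\in\{0,1\}\qquad\text{and}\qquad |\mathcal{D}^\times_n(\psi)|\in\{0,1\}.$$
   Context: For $q\in\mathbb{N}$ and $x\in\mathbb{R}$, $\|qx\|:=\min\{|qx-p|:p\in\mathbb{Z}\}$ and $\|qx\|':=\min\{|qx-p|:p\in\mathbb{Z},\ \gcd(p,q)=1\}$. Define $$\mathcal{S}^\times_n(\psi):=\Big\{(x_1,\dots,x_n)\in[0,1]^n:\ \prod_{i=1}^n\|qx_i\|<\psi(q)\text{ for infinitely many }q\in\mathbb{N}\Big\},$$ $$\mathcal{D}^\times_n(\psi):=\Big\{(x_1,\dots,x_n)\in[0,1]^n:\ \prod_{i=1}^n\|qx_i\|'<\psi(q)\text{ for infinitely many }q\in\mathbb{N}\Big\}.$$ $|\cdot|$ denotes $n$-dimensional Lebesgue measure. *)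

theory Defs
  imports "HOL-Analysis.Analysis"
begin

definition dist_int :: "nat \<Rightarrow> real \<Rightarrow> real" where
  "dist_int q x = (INF p\<in>(UNIV :: int set). \<bar>of_nat q * x - of_int p\<bar>)"

definition dist_cop :: "nat \<Rightarrow> real \<Rightarrow> real" where
  "dist_cop q x = (INF p\<in>{p :: int. gcd p (int q) = 1}. \<bar>of_nat q * x - of_int p\<bar>)"

text \<open>The dimension is the cardinality of the index type. The condition \<open>1 \<le> q\<close> keeps
  the value of \<open>\<psi>\<close> at zero irrelevant.\<close>

definition S_mult :: "(nat \<Rightarrow> real) \<Rightarrow> (real ^ 'n::finite) set" where
  "S_mult \<psi> = {x. (\<forall>i. x $ i \<in> {0..1}) \<and>
     infinite {q. 1 \<le> q \<and> (\<Prod>i\<in>UNIV. dist_int q (x $ i)) < \<psi> q}}"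

definition D_mult :: "(nat \<Rightarrow> real) \<Rightarrow> (real ^ 'n::finite) set" where
  "D_mult \<psi> = {x. (\<forall>i. x $ i \<in> {0..1}) \<and>
     infinite {q. 1 \<le> q \<and> (\<Prod>i\<in>UNIV. dist_cop q (x $ i)) < \<psi> q}}"

text \<open>The infima above are minima, so they agree with the usual definitions of the distance
  to the nearest integer and to the nearest integer coprime to \<open>q\<close>.\<close>

lemma INF_abs_diff_int_attained:
  fixes y :: real and P :: "int set"
  assumes "P \<noteq> {}"
  shows "\<exists>p\<in>P. (INF p\<in>P. \<bar>y - of_int p\<bar>) = \<bar>y - of_int p\<bar>"
proof -
  obtain p0 where p0: "p0 \<in> P" using assms by blast
  define R where "R = \<bar>y - of_int p0\<bar>"
  define F where "F = {p \<in> P. \<bar>y - of_int p\<bar> \<le> R}"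
  have "F \<subseteq> {\<lfloor>y - R\<rfloor>..\<lceil>y + R\<rceil>}"
  proof
    fix p assume "p \<in> F"
    then have "y - R \<le> of_int p" "of_int p \<le> y + R" by (simp_all add: F_def abs_le_iff)
    then show "p \<in> {\<lfloor>y - R\<rfloor>..\<lceil>y + R\<rceil>}" by (simp add: floor_le_iff le_ceiling_iff)
  qed
  then have fin: "finite F" by (rule finite_subset) simp
  have ne: "F \<noteq> {}" using p0 by (auto simp: F_def R_def)
  obtain m where m: "m \<in> F" "\<And>p. p \<in> F \<Longrightarrow> \<bar>y - of_int m\<bar> \<le> \<bar>y - of_int p\<bar>"
  proof -
    let ?g = "\<lambda>p. \<bar>y - of_int p\<bar> :: real"
    have "Min (?g ` F) \<in> ?g ` F" using fin ne by (intro Min_in) simp_all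
    then obtain m where "Min (?g ` F) = ?g m" "m \<in> F" by (rule imageE)
    then have "?g m \<le> ?g p" if "p \<in> F" for p
      using Min_le[of "?g ` F" "?g p"] fin that by simp
    with \<open>m \<in> F\<close> show thesis by (rule that)
  qed
  have "\<bar>y - of_int m\<bar> \<le> \<bar>y - of_int p\<bar>" if "p \<in> P" for p
    using m that by (cases "p \<in> F") (auto simp: F_def)
  then have "(INF p\<in>P. \<bar>y - of_int p\<bar>) = \<bar>y - of_int m\<bar>"
    using m(1) by (intro cInf_eq_minimum) (auto simp: F_def)
  then show ?thesis using m(1) by (auto simp: F_def)
qed

lemma dist_int_attained: "\<exists>p::int. dist_int q x = \<bar>of_nat q * x - of_int p\<bar>"
  using INF_abs_diff_int_attained[of UNIV "of_nat q * x"] unfolding dist_int_def by blast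

lemma dist_cop_attained:
  "\<exists>p::int. gcd p (int q) = 1 \<and> dist_cop q x = \<bar>of_nat q * x - of_int p\<bar>"
proof -
  have "{p :: int. gcd p (int q) = 1} \<noteq> {}"
    by (simp, rule exI[of _ 1], simp)
  from INF_abs_diff_int_attained[OF this, of "of_nat q * x"] show ?thesis
    unfolding dist_cop_def by (simp only: mem_Collect_eq Bex_def)
qed

lemma dist_int_le: "dist_int q x \<le> \<bar>of_nat q * x - of_int p\<bar>"
  unfolding dist_int_def by (rule cINF_lower) (auto intro!: bdd_belowI2[of _ 0])

lemma dist_cop_le: "gcd p (int q) = 1 \<Longrightarrow> dist_cop q x \<le> \<bar>of_nat q * x - of_int p\<bar>"
  unfolding dist_cop_def by (rule cINF_lower) (auto intro!: bdd_belowI2[of _ 0])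

text \<open>\<open>emeasure\<close> is zero by convention on non-measurable sets; the following facts show that
  this convention does not intervene for the sets defined here.\<close>

lemma dist_int_measurable [measurable]: "dist_int q \<in> borel_measurable borel"
  unfolding dist_int_def[abs_def]
  by (intro borel_measurable_cINF_real) simp_all

lemma dist_cop_measurable [measurable]: "dist_cop q \<in> borel_measurable borel"
  unfolding dist_cop_def[abs_def]
  by (intro borel_measurable_cINF_real) simp_all

lemma limsup_set_borel:
  fixes f :: "nat \<Rightarrow> real \<Rightarrow> real"
  assumes [measurable]: "\<And>q. f q \<in> borel_measurable borel"
  shows "{x :: real ^ 'n::finite. (\<forall>i. x $ i \<in> {0..1}) \<and>
           infinite {q. 1 \<le> q \<and> (\<Prod>i\<in>UNIV. f q (x $ i)) < \<psi> q}} \<in> sets borel"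
proof -
  have [measurable]: "(\<lambda>x :: real ^ 'n. x $ i) \<in> borel_measurable borel" for i
    by (intro borel_measurable_continuous_onI continuous_intros)
  show ?thesis
    unfolding infinite_nat_iff_unbounded by measurable
qed

lemma S_mult_borel: "(S_mult \<psi> :: (real ^ 'n::finite) set) \<in> sets borel"
  unfolding S_mult_def by (rule limsup_set_borel[where f = dist_int]) (rule dist_int_measurable)

lemma D_mult_borel: "(D_mult \<psi> :: (real ^ 'n::finite) set) \<in> sets borel"
  unfolding D_mult_def by (rule limsup_set_borel[where f = dist_cop]) (rule dist_cop_measurable)

end

theory Submission
  imports Defs "HOL-Computational_Algebra.Primes"
begin

text \<open>Along each coordinate the condition has the one-dimensional form \<open>\<parallel>q t\<parallel> c(q) < \<psi>(q)\<close>, so by a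
  Fubini argument it suffices to know that every one-dimensional fibre is null or full.

  In dimension one, Vitali's covering theorem shows that multiplying the radii of a limsup set of
  shrinking intervals by a constant changes it only by a null set (Cassels). Hence the limsup
  set is, up to a null set, invariant under every expanding affine map that preserves the
  centres, and is therefore null or full. For arbitrary fractions the map \<open>t \<mapsto> 2 t\<close> does this. For
  reduced fractions (Gallagher) the denominators \<open>q\<close> are split by a prime \<open>l\<close>: if \<open>l\<close> does not divide
  \<open>q\<close>, use \<open>t \<mapsto> l t\<close>; if \<open>l\<close> divides \<open>q\<close> exactly once, use \<open>t \<mapsto> l t + 1/l\<close>; if \<open>l\<^sup>2\<close> divides \<open>q\<close>, the
  centres are invariant under translation by \<open>1/l\<close>. If the first two parts are null for every \<open>l\<close>,
  the set has arbitrarily small periods up to null sets, which again forces it to be null or full.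
  If the radii do not tend to zero, the set is the whole line, because the reduced
  fractions with denominator \<open>q\<close> become dense as \<open>q\<close> grows.\<close>

subsection \<open>Low density and periodicity\<close>

text \<open>A one-sided form of Lebesgue's density theorem. Vitali's theorem covers a piece
  \<open>F\<close> of finite measure, up to a null set, by disjoint balls of low density inside an
  open \<open>G\<close> only slightly larger than \<open>F\<close>; summing gives |F| \<le> \<delta>
  |G|, which forces |F| = 0.\<close>

lemma negligible_low_density:
  fixes E :: "'a::euclidean_space set"
  assumes E: "E \<in> sets lebesgue" and \<delta>: "0 \<le> \<delta>" "\<delta> < 1"
    and small: "\<And>x \<epsilon>. x \<in> E \<Longrightarrow> 0 < \<epsilon> \<Longrightarrow> \<exists>y \<rho>. 0 < \<rho> \<and> \<rho> < \<epsilon> \<and> x \<in> cball y \<rho> \<and>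
        measure lebesgue (E \<inter> cball y \<rho>) \<le> \<delta> * measure lebesgue (cball y \<rho>)"
  shows "negligible E"
proof -
  \<comment> \<open>Finite measure allows \<delta> |F| to be absorbed at the end; \<open>E\<close>
    itself is exhausted by its intersections with large balls.\<close>
  have bounded: "negligible F" if F: "F \<in> lmeasurable" "F \<subseteq> E" for F
  proof -
    have approx: "measure lebesgue F \<le> \<delta> * (measure lebesgue F + e)" if e: "0 < e" for e
    proof -
      obtain G where G: "open G" "F \<subseteq> G" "G \<in> lmeasurable" "measure lebesgue G < measure lebesgue F + e"
      proof -
        obtain T where T: "open T" "F \<subseteq> T" "T - F \<in> lmeasurable" "emeasure lebesgue (T - F) < ennreal e"
          using sets_lebesgue_outer_open[OF fmeasurableD[OF F(1)] e] by blast
        then have "T = F \<union> (T - F)" by blast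
        then have "T \<in> lmeasurable" "measure lebesgue T = measure lebesgue F + measure lebesgue (T - F)"
          using F(1) T(3) by (metis fmeasurable.Un, metis measure_Un3 Diff_disjoint diff_zero measure_empty)
        moreover have "measure lebesgue (T - F) < e"
          using T(3,4) e by (simp add: emeasure_eq_measure2 ennreal_less_iff)
        ultimately show thesis using T that by simp
      qed
      define K where "K = {(y, \<rho>). 0 < \<rho> \<and> cball y \<rho> \<subseteq> G \<and>
        measure lebesgue (E \<inter> cball y \<rho>) \<le> \<delta> * measure lebesgue (cball y \<rho>)}"
      let ?B = "\<lambda>i. cball (fst i) (snd i)"
      obtain C where C: "countable C" "C \<subseteq> K" "pairwise (\<lambda>i j. disjnt (?B i) (?B j)) C"
        "negligible (F - (\<Union>i\<in>C. ?B i))"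
      proof (rule Vitali_covering_theorem_cballs[of K snd F fst])
        show "0 < snd i" if "i \<in> K" for i using that by (auto simp: K_def)
        fix x d assume x: "x \<in> F" "0 < (d::real)"
        obtain s where s: "0 < s" "ball x s \<subseteq> G"
          using G(1,2) x(1) by (meson open_contains_ball subsetD)
        \<comment> \<open>The bound \<open>d\<close> gives the fineness that Vitali's theorem asks
          for; \<open>s/2\<close> keeps a ball that merely contains \<open>x\<close> inside
          \<open>ball x s\<close>.\<close>
        obtain y \<rho> where y: "0 < \<rho>" "\<rho> < min d (s/2)" "x \<in> cball y \<rho>"
          "measure lebesgue (E \<inter> cball y \<rho>) \<le> \<delta> * measure lebesgue (cball y \<rho>)"
          using small[of x "min d (s/2)"] x s F(2) by auto
        have "cball y \<rho> \<subseteq> ball x s"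
        proof
          fix z assume "z \<in> cball y \<rho>"
          then show "z \<in> ball x s" using y(2,3) dist_triangle[of x z y]
            by (simp add: dist_commute)
        qed
        with y s show "\<exists>i. i \<in> K \<and> x \<in> ?B i \<and> snd i < d"
          by (intro exI[of _ "(y,\<rho>)"]) (auto simp: K_def)
      qed blast
      have disj: "disjoint_family_on ?B C"
        using C(3) unfolding disjoint_family_on_def pairwise_def disjnt_def by blast
      have disj': "disjoint_family_on (\<lambda>i. F \<inter> ?B i) C"
        unfolding disjoint_family_on_def
      proof (intro ballI impI)
        fix i j assume "i \<in> C" "j \<in> C" "i \<noteq> j"
        then have "?B i \<inter> ?B j = {}" by (rule disjoint_family_onD[OF disj])
        then show "(F \<inter> ?B i) \<inter> (F \<inter> ?B j) = {}" by blast
      qed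
      have Fs: "F \<in> sets lebesgue" using F by blast
      have "emeasure lebesgue F = emeasure lebesgue (F \<inter> (\<Union>i\<in>C. ?B i))"
      proof -
        have "F - (\<Union>i\<in>C. ?B i) \<in> null_sets lebesgue"
          using C(4) by (simp add: negligible_iff_null_sets)
        then have "emeasure lebesgue (F - (F - (\<Union>i\<in>C. ?B i))) = emeasure lebesgue F"
          using Fs by (rule emeasure_Diff_null_set)
        then show ?thesis by (simp add: Diff_Diff_Int)
      qed
      also have "\<dots> = emeasure lebesgue (\<Union>i\<in>C. F \<inter> ?B i)" by (simp only: Int_UN_distrib)
      also have "\<dots> = (\<integral>\<^sup>+i. emeasure lebesgue (F \<inter> ?B i) \<partial>count_space C)"
        using Fs by (intro emeasure_UN_countable[OF _ C(1) disj']) auto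
      also have "\<dots> \<le> (\<integral>\<^sup>+i. ennreal \<delta> * emeasure lebesgue (?B i) \<partial>count_space C)"
      proof (intro nn_integral_mono)
        fix i assume "i \<in> space (count_space C)"
        with C(2) have "measure lebesgue (E \<inter> ?B i) \<le> \<delta> * measure lebesgue (?B i)"
          by (auto simp: K_def)
        moreover have "emeasure lebesgue (F \<inter> ?B i) \<le> emeasure lebesgue (E \<inter> ?B i)"
          using F E by (intro emeasure_mono) auto
        moreover have "E \<inter> ?B i \<in> lmeasurable" "?B i \<in> lmeasurable"
          using E by (auto intro!: bounded_set_imp_lmeasurable bounded_Int)
        ultimately show "emeasure lebesgue (F \<inter> ?B i) \<le> ennreal \<delta> * emeasure lebesgue (?B i)"
          using \<delta> by (auto simp: emeasure_eq_measure2 simp flip: ennreal_mult' intro: order_trans ennreal_leI)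
      qed
      also have "\<dots> = ennreal \<delta> * (\<integral>\<^sup>+i. emeasure lebesgue (?B i) \<partial>count_space C)"
        by (simp add: nn_integral_cmult)
      also have "(\<integral>\<^sup>+i. emeasure lebesgue (?B i) \<partial>count_space C) = emeasure lebesgue (\<Union>i\<in>C. ?B i)"
        by (intro emeasure_UN_countable[OF _ C(1) disj, symmetric]) auto
      also have "\<dots> \<le> emeasure lebesgue G"
        using C(2) G(3) by (intro emeasure_mono UN_least) (force simp: K_def)+
      finally have "emeasure lebesgue F \<le> ennreal \<delta> * emeasure lebesgue G"
        by (simp add: mult_left_mono)
      then have "measure lebesgue F \<le> \<delta> * measure lebesgue G"
        using F G \<delta> by (simp add: emeasure_eq_measure2 flip: ennreal_mult')
      also have "\<dots> \<le> \<delta> * (measure lebesgue F + e)"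
        using \<delta> G by (intro mult_left_mono) auto
      finally show ?thesis .
    qed
    have "measure lebesgue F \<le> \<delta> * measure lebesgue F + e" if e: "0 < e" for e
    proof -
      have "\<delta> * e \<le> e" using e \<delta> by (simp add: mult_left_le_one_le)
      with approx[OF e] show ?thesis by (simp add: distrib_left)
    qed
    then have "measure lebesgue F \<le> \<delta> * measure lebesgue F"
      by (rule field_le_epsilon)
    then have "(1 - \<delta>) * measure lebesgue F \<le> 0" by (simp add: algebra_simps)
    then have "measure lebesgue F \<le> 0" using \<delta> by (simp add: mult_le_0_iff)
    then have "measure lebesgue F = 0" by (simp add: order_antisym)
    then show ?thesis using F by (simp add: negligible_iff_measure)
  qed
  have "negligible (E \<inter> cball 0 (real n))" for n
  proof (rule bounded)
    show "E \<inter> cball 0 (real n) \<in> lmeasurable"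
      using E by (intro bounded_set_imp_lmeasurable) (auto intro: bounded_Int)
  qed simp
  then have "negligible (\<Union>n::nat. E \<inter> cball 0 (real n))"
    by (intro negligible_countable_Union countable_image) auto
  moreover have "E = (\<Union>n::nat. E \<inter> cball 0 (real n))"
  proof (intro equalityI subsetI)
    fix x assume "x \<in> E"
    moreover obtain n where "norm x \<le> real n" using real_arch_simple by blast
    ultimately show "x \<in> (\<Union>n::nat. E \<inter> cball 0 (real n))" by auto
  qed blast
  ultimately show ?thesis by simp
qed

text \<open>Every window of length \<open>d\<close> carries the same mass: translate it by a
  multiple of \<open>d\<close> until it starts in [0, d), cut it at \<open>d\<close>, and move the
  right piece back by one period.\<close>

lemma measure_periodic_interval:
  fixes A :: "real set"
  assumes A: "A \<in> sets lebesgue" and d: "0 < d" and per: "\<And>x. x + d \<in> A \<longleftrightarrow> x \<in> A"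
  shows "measure lebesgue (A \<inter> {a..a + real n * d}) = real n * measure lebesgue (A \<inter> {0..d})"
proof -
  \<comment> \<open>Half-open intervals tile the line without overlap; \<open>closed\<close> returns
    to closed intervals, which differ by one point.\<close>
  let ?m = "\<lambda>a b. measure lebesgue (A \<inter> {a..<b})"
  have per_int: "x + of_int n * d \<in> A \<longleftrightarrow> x \<in> A" for x and n :: int
  proof (induction n rule: int_induct[where k = 0])
    case (step1 i)
    then show ?case using per[of "x + of_int i * d"] by (simp add: algebra_simps)
  next
    case (step2 i)
    then show ?case using per[of "x + of_int (i - 1) * d"] by (simp add: algebra_simps)
  qed simp
  have shift: "?m (a + of_int n * d) (b + of_int n * d) = ?m a b" for a b and n :: int
  proof -
    have "A \<inter> {a + of_int n * d..<b + of_int n * d} = (+) (of_int n * d) ` (A \<inter> {a..<b})"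
    proof (intro set_eqI iffI)
      fix x assume "x \<in> A \<inter> {a + of_int n * d..<b + of_int n * d}"
      then have "x - of_int n * d \<in> A \<inter> {a..<b}"
        using per_int[of "x - of_int n * d" n] by auto
      then show "x \<in> (+) (of_int n * d) ` (A \<inter> {a..<b})"
        by (intro image_eqI[of _ _ "x - of_int n * d"]) auto
    next
      fix x assume "x \<in> (+) (of_int n * d) ` (A \<inter> {a..<b})"
      then obtain z where "z \<in> A" "a \<le> z" "z < b" "x = z + of_int n * d" by auto
      then show "x \<in> A \<inter> {a + of_int n * d..<b + of_int n * d}"
        using per_int[of z n] by auto
    qed
    then show ?thesis by (simp only: measure_translation)
  qed
  have meas: "A \<inter> {a..<b} \<in> lmeasurable" for a b
    using A by (intro bounded_set_imp_lmeasurable) (auto intro: bounded_subset[OF bounded_closed_interval])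
  have split: "?m a b + ?m b c = ?m a c" if "a \<le> b" "b \<le> c" for a b c
  proof -
    have "A \<inter> {a..<c} = (A \<inter> {a..<b}) \<union> (A \<inter> {b..<c})" using that by auto
    moreover have "(A \<inter> {a..<b}) \<inter> (A \<inter> {b..<c}) = {}" by auto
    ultimately show ?thesis by (simp add: measure_Un3 meas)
  qed
  have closed: "measure lebesgue (A \<inter> {a..b}) = ?m a b" for a b
    by (rule measure_negligible_symdiff[OF meas], rule negligible_subset[of "{b}"]) auto
  have one: "?m a (a+d) = ?m 0 d" for a
  proof -
    \<comment> \<open>The residue of \<open>a\<close> modulo \<open>d\<close>.\<close>
    define f where "f = a - of_int \<lfloor>a/d\<rfloor> * d"
    have f: "0 \<le> f" "f < d"
      using floor_divide_lower[OF d, of a] floor_divide_upper[OF d, of a]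
      by (simp_all add: f_def algebra_simps)
    have "?m a (a+d) = ?m f (f+d)"
      using shift[of f "\<lfloor>a/d\<rfloor>" "f+d"] by (simp add: algebra_simps f_def)
    also have "\<dots> = ?m f d + ?m d (f+d)" using f by (intro split[symmetric]) auto
    also have "?m d (f+d) = ?m 0 f" using shift[of 0 1 f] by simp
    also have "?m f d + ?m 0 f = ?m 0 d" using split[of 0 f d] f by simp
    finally show ?thesis .
  qed
  have "?m a (a + real n * d) = real n * ?m 0 d"
  proof (induction n)
    case (Suc n)
    have "?m a (a + real (Suc n) * d) = ?m a (a + real n * d) + ?m (a + real n * d) (a + real n * d + d)"
      using d by (subst split) (auto simp: algebra_simps)
    then show ?case using Suc one[of "a + real n * d"] by (simp add: algebra_simps)
  qed simp
  then show ?thesis by (simp add: closed)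
qed

lemma measure_unit_interval_periodic:
  fixes A :: "real set"
  assumes "A \<in> sets lebesgue" and "\<And>x. x + 1 \<in> A \<longleftrightarrow> x \<in> A"
  shows "measure lebesgue (A \<inter> {a..a+1}) = measure lebesgue (A \<inter> {0..1})"
  using measure_periodic_interval[OF assms(1) _ assms(2), of a 1] by simp

text \<open>Extends nullity from one period to the whole line, so that null parts can later be
  discarded on any window.\<close>

lemma negligible_periodic:
  fixes A :: "real set"
  assumes A: "A \<in> sets lebesgue" and per: "\<And>x. x + 1 \<in> A \<longleftrightarrow> x \<in> A"
    and null: "measure lebesgue (A \<inter> {0..1}) = 0"
  shows "negligible A"
proof -
  have "A \<inter> {a..a+1} \<in> lmeasurable" for a
    using A by (auto intro!: bounded_set_imp_lmeasurable intro: bounded_subset[OF bounded_closed_interval])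
  then have "negligible (A \<inter> {a..a+1})" for a
    using measure_unit_interval_periodic[OF A per, of a] null by (simp add: negligible_iff_measure)
  then have "negligible (\<Union>n::int. A \<inter> {of_int n..of_int n+1})"
    by (intro negligible_countable_Union countable_image) auto
  moreover have "A \<subseteq> (\<Union>n::int. A \<inter> {of_int n..of_int n+1})"
  proof
    fix x assume "x \<in> A"
    then have "x \<in> A \<inter> {of_int \<lfloor>x\<rfloor>..of_int \<lfloor>x\<rfloor> + 1}"
      using floor_correct[of x] by auto
    then show "x \<in> (\<Union>n::int. A \<inter> {of_int n..of_int n+1})" by (rule UN_I[OF UNIV_I])
  qed
  ultimately show ?thesis by (rule negligible_subset)
qed

text \<open>If the mass in [0, 1] is some number below 1, that number serves as the uniform density
  bound \<delta> for short intervals centred at each point, and the set is null.\<close>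

lemma measure_zero_one_low_density:
  fixes A :: "real set"
  assumes A: "A \<in> sets lebesgue"
    and low: "\<And>\<epsilon>. 0 < \<epsilon> \<Longrightarrow> \<exists>h. 0 < h \<and> h < \<epsilon> \<and>
      (\<forall>a. measure lebesgue (A \<inter> {a..a+h}) \<le> h * measure lebesgue (A \<inter> {0..1}))"
  shows "measure lebesgue (A \<inter> {0..1}) \<in> {0, 1}"
proof (cases "measure lebesgue (A \<inter> {0..1}) < 1")
  case True
  have "negligible A"
  proof (rule negligible_low_density[OF A _ True])
    fix x \<epsilon> :: real assume "0 < \<epsilon>"
    then obtain h where h: "0 < h" "h < \<epsilon>"
      "\<And>a. measure lebesgue (A \<inter> {a..a+h}) \<le> h * measure lebesgue (A \<inter> {0..1})"
      using low by blast
    have eq: "cball x (h/2) = {x - h/2..(x - h/2) + h}" by (simp add: cball_eq_atLeastAtMost)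
    have "measure lebesgue (A \<inter> cball x (h/2)) \<le> measure lebesgue (A \<inter> {0..1}) * measure lebesgue (cball x (h/2))"
      unfolding eq using h(1) h(3)[of "x - h/2"] by (simp add: mult.commute)
    with h show "\<exists>y \<rho>. 0 < \<rho> \<and> \<rho> < \<epsilon> \<and> x \<in> cball y \<rho> \<and> measure lebesgue (A \<inter> cball y \<rho>) \<le>
        measure lebesgue (A \<inter> {0..1}) * measure lebesgue (cball y \<rho>)"
      by - (rule exI[of _ x], rule exI[of _ "h/2"], simp)
  qed simp
  then have "negligible (A \<inter> {0..1})" by (rule negligible_subset) simp
  then show ?thesis by (simp add: negligible_imp_measure0)
next
  case False
  have "measure lebesgue (A \<inter> {0..1}) \<le> measure lebesgue {0..1::real}"
    using A by (intro measure_mono_fmeasurable) auto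
  with False show ?thesis by simp
qed

subsection \<open>Limsup sets of intervals\<close>

text \<open>An index with empty \<open>C q\<close> contributes nothing, so the denominators can be
  restricted by replacing centre sets with the empty set while the radii stay fixed.\<close>

definition limsup_balls :: "(nat \<Rightarrow> real set) \<Rightarrow> (nat \<Rightarrow> real) \<Rightarrow> real set" where
  "limsup_balls C r = {x. infinite {q. \<exists>y\<in>C q. \<bar>x - y\<bar> < r q}}"

lemma limsup_balls_borel [measurable]: "limsup_balls C r \<in> sets borel"
proof -
  have "limsup_balls C r = (\<Inter>N. \<Union>q\<in>{N<..}. \<Union>y\<in>C q. ball y (r q))"
    by (simp add: set_eq_iff limsup_balls_def infinite_nat_iff_unbounded dist_real_def abs_minus_commute Bex_def)
  also have "\<dots> \<in> sets borel"
    by (intro sets.countable_INT image_subsetI borel_open open_UN ballI open_ball) auto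
  finally show ?thesis .
qed

lemma limsup_balls_lebesgue: "limsup_balls C r \<in> sets lebesgue"
  using limsup_balls_borel by (simp add: sets_completionI_sets)

lemma limsup_balls_mono:
  assumes "\<And>q. C q \<subseteq> C' q" "\<And>q. r q \<le> r' q"
  shows "limsup_balls C r \<subseteq> limsup_balls C' r'"
proof -
  have "{q. \<exists>y\<in>C q. \<bar>x - y\<bar> < r q} \<subseteq> {q. \<exists>y\<in>C' q. \<bar>x - y\<bar> < r' q}" for x
    using assms by (blast intro: order_less_le_trans)
  then show ?thesis
    unfolding limsup_balls_def by (blast dest: infinite_super)
qed

text \<open>Cassels' scaling argument. A point of the large limsup set that avoids all small
  intervals of index beyond \<open>N\<close> lies in arbitrarily short intervals of radius
  \<open>k * r q\<close>. The exceptional set \<open>E N\<close> misses the concentric interval of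
  radius \<open>r q\<close>, a proportion 1/k, so its density there is at most 1 - 1/k.\<close>

lemma negligible_limsup_balls_scale:
  assumes r: "r \<longlonglongrightarrow> 0" and k: "1 \<le> k"
  shows "negligible (limsup_balls C (\<lambda>q. k * r q) - limsup_balls C r)"
proof -
  define E where "E N = limsup_balls C (\<lambda>q. k * r q) - (\<Union>q\<in>{N<..}. \<Union>y\<in>C q. ball y (r q))" for N
  have E: "E N \<in> sets lebesgue" for N
    unfolding E_def by (intro sets.Diff limsup_balls_lebesgue sets_completionI_sets)
      (auto intro!: borel_open open_UN)
  have "negligible (E N)" for N
  proof (rule negligible_low_density[OF E, of "1 - 1/k"])
    fix x \<epsilon> :: real assume x: "x \<in> E N" and \<epsilon>: "0 < \<epsilon>"
    from r have "(\<lambda>q. k * r q) \<longlonglongrightarrow> 0" by (rule tendsto_mult_right_zero)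
    then have "eventually (\<lambda>q. k * r q < \<epsilon>) sequentially" using \<epsilon> by (rule order_tendstoD)
    then obtain M where M: "\<And>q. M \<le> q \<Longrightarrow> k * r q < \<epsilon>" by (auto simp: eventually_sequentially)
    from x have "infinite {q. \<exists>y\<in>C q. \<bar>x - y\<bar> < k * r q}" by (simp add: E_def limsup_balls_def)
    then obtain q where q: "max M N < q" "\<exists>y\<in>C q. \<bar>x - y\<bar> < k * r q"
      unfolding infinite_nat_iff_unbounded by blast
    then obtain y where y: "y \<in> C q" "\<bar>x - y\<bar> < k * r q" by blast
    then have pos: "0 < k * r q" by linarith
    with k have rpos: "0 < r q" by (simp add: zero_less_mult_iff)
    have le: "r q \<le> k * r q" using rpos k by simp
    have "E N \<inter> cball y (k * r q) \<subseteq> cball y (k * r q) - ball y (r q)"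
      using q y by (auto simp: E_def)
    then have "measure lebesgue (E N \<inter> cball y (k * r q)) \<le> measure lebesgue (cball y (k * r q) - ball y (r q))"
      using E by (intro measure_mono_fmeasurable) auto
    also have "\<dots> = measure lebesgue (cball y (k * r q)) - measure lebesgue (ball y (r q))"
      using le by (intro measurable_measure_Diff) auto
    also have "\<dots> = (1 - 1/k) * measure lebesgue (cball y (k * r q))"
      using rpos pos k by (simp add: cball_eq_atLeastAtMost ball_eq_greaterThanLessThan field_simps)
    finally show "\<exists>y \<rho>. 0 < \<rho> \<and> \<rho> < \<epsilon> \<and> x \<in> cball y \<rho> \<and>
        measure lebesgue (E N \<inter> cball y \<rho>) \<le> (1 - 1/k) * measure lebesgue (cball y \<rho>)"
      using pos M[of q] q y by - (rule exI[of _ y], rule exI[of _ "k * r q"], auto simp: dist_real_def abs_minus_commute)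
  qed (use k in auto)
  then have "negligible (\<Union>N. E N)" by (intro negligible_countable_Union countable_image) auto
  moreover have "limsup_balls C (\<lambda>q. k * r q) - limsup_balls C r \<subseteq> (\<Union>N. E N)"
  proof
    fix x assume x: "x \<in> limsup_balls C (\<lambda>q. k * r q) - limsup_balls C r"
    then have "finite {q. \<exists>y\<in>C q. \<bar>x - y\<bar> < r q}" by (simp add: limsup_balls_def)
    then obtain N where "{q. \<exists>y\<in>C q. \<bar>x - y\<bar> < r q} \<subseteq> {..N}" unfolding finite_nat_iff_bounded_le by blast
    then have "\<not> \<bar>x - y\<bar> < r q" if "N < q" "y \<in> C q" for q y using that by force
    then have "x \<in> E N" using x by (simp add: E_def dist_real_def abs_minus_commute)
    then show "x \<in> (\<Union>N. E N)" by blast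
  qed
  ultimately show ?thesis by (rule negligible_subset)
qed

lemma limsup_balls_shift:
  assumes "\<And>q y. y + d \<in> C q \<longleftrightarrow> y \<in> C q"
  shows "x + d \<in> limsup_balls C r \<longleftrightarrow> x \<in> limsup_balls C r"
proof -
  have "(\<exists>y\<in>C q. \<bar>x + d - y\<bar> < r q) \<longleftrightarrow> (\<exists>y\<in>C q. \<bar>x - y\<bar> < r q)" for q
  proof
    assume "\<exists>y\<in>C q. \<bar>x + d - y\<bar> < r q"
    then obtain y where "y \<in> C q" "\<bar>x + d - y\<bar> < r q" by blast
    then show "\<exists>y\<in>C q. \<bar>x - y\<bar> < r q"
      using assms[of "y - d" q] by (intro bexI[of _ "y - d"]) (auto simp: algebra_simps)
  next
    assume "\<exists>y\<in>C q. \<bar>x - y\<bar> < r q"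
    then obtain y where "y \<in> C q" "\<bar>x - y\<bar> < r q" by blast
    then show "\<exists>y\<in>C q. \<bar>x + d - y\<bar> < r q"
      using assms[of y q] by (intro bexI[of _ "y + d"]) auto
  qed
  then show ?thesis by (simp add: limsup_balls_def)
qed

text \<open>The map t -> l t + c preserves centres and multiplies distances by \<open>l\<close>.
  Taking the union over all radii \<open>l ^ k * r q\<close> makes the limsup set exactly forward
  invariant, at the cost of a null set. Expanding a short interval to unit length then bounds its
  density by that of a full period.\<close>

lemma measure_limsup_balls_affine:
  assumes r: "r \<longlonglongrightarrow> 0" and l: "1 < l"
    and per: "\<And>q y. y + 1 \<in> C q \<longleftrightarrow> y \<in> C q"
    and affine: "\<And>q y. y \<in> C q \<Longrightarrow> l * y + c \<in> C q"
  shows "measure lebesgue (limsup_balls C r \<inter> {0..1}) \<in> {0, 1}"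
proof -
  define A where "A = (\<Union>k. limsup_balls C (\<lambda>q. l ^ k * r q))"
  have A: "A \<in> sets lebesgue"
    unfolding A_def by (intro sets.countable_UN) (auto intro: limsup_balls_lebesgue)
  have A_int: "A \<inter> {a..b} \<in> lmeasurable" for a b
    using A by (auto intro!: bounded_set_imp_lmeasurable intro: bounded_subset[OF bounded_closed_interval])
  have A_per: "x + 1 \<in> A \<longleftrightarrow> x \<in> A" for x
    unfolding A_def using limsup_balls_shift[of 1 C, OF per] by auto
  \<comment> \<open>The map carries level \<open>k\<close> of the union into level
    \<open>Suc k\<close>.\<close>
  have A_affine: "l * x + c \<in> A" if "x \<in> A" for x
  proof -
    from that obtain k where k: "infinite {q. \<exists>y\<in>C q. \<bar>x - y\<bar> < l ^ k * r q}"
      by (auto simp: A_def limsup_balls_def)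
    have "(\<exists>y\<in>C q. \<bar>x - y\<bar> < l ^ k * r q) \<Longrightarrow> (\<exists>y\<in>C q. \<bar>l * x + c - y\<bar> < l ^ Suc k * r q)" for q
    proof -
      assume "\<exists>y\<in>C q. \<bar>x - y\<bar> < l ^ k * r q"
      then obtain y where y: "y \<in> C q" "\<bar>x - y\<bar> < l ^ k * r q" by blast
      have "\<bar>l * x + c - (l * y + c)\<bar> = l * \<bar>x - y\<bar>"
        using l by (simp add: abs_mult flip: right_diff_distrib)
      also have "\<dots> < l * (l ^ k * r q)" using y l by simp
      finally show ?thesis using affine[OF y(1)] by (intro bexI[of _ "l * y + c"]) (auto simp: mult.assoc)
    qed
    then have "{q. \<exists>y\<in>C q. \<bar>x - y\<bar> < l ^ k * r q} \<subseteq> {q. \<exists>y\<in>C q. \<bar>l * x + c - y\<bar> < l ^ Suc k * r q}"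
      by fast
    then have "infinite {q. \<exists>y\<in>C q. \<bar>l * x + c - y\<bar> < l ^ Suc k * r q}"
      using k by (rule infinite_super)
    then have "l * x + c \<in> limsup_balls C (\<lambda>q. l ^ Suc k * r q)" unfolding limsup_balls_def by blast
    then show ?thesis unfolding A_def by blast
  qed
  \<comment> \<open>Only forward invariance is available, hence an inequality. The left endpoint
    varies in the induction because the map moves \<open>a\<close> to
    \<open>l * a + c\<close>.\<close>
  have density: "measure lebesgue (A \<inter> {a..a + 1 / l ^ j}) \<le> 1 / l ^ j * measure lebesgue (A \<inter> {0..1})" for a j
  proof (induction j arbitrary: a)
    case 0
    then show ?case using measure_unit_interval_periodic[OF A A_per] by simp
  next
    case (Suc j)
    let ?T = "\<lambda>x. l *\<^sub>R x + c"
    have "?T ` (A \<inter> {a..a + 1 / l ^ Suc j}) \<subseteq> A \<inter> {l * a + c..l * a + c + 1 / l ^ j}"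
    proof
      fix z assume "z \<in> ?T ` (A \<inter> {a..a + 1 / l ^ Suc j})"
      then obtain x where x: "x \<in> A" "a \<le> x" "x \<le> a + 1 / l ^ Suc j" "z = l * x + c" by auto
      have "l * x \<le> l * (a + 1 / l ^ Suc j)" using x l by (intro mult_left_mono) auto
      also have "\<dots> = l * a + 1 / l ^ j" using l by (simp add: field_simps)
      finally show "z \<in> A \<inter> {l * a + c..l * a + c + 1 / l ^ j}"
        using x l A_affine[of x] by auto
    qed
    then have "emeasure lebesgue (?T ` (A \<inter> {a..a + 1 / l ^ Suc j})) \<le>
        emeasure lebesgue (A \<inter> {l * a + c..l * a + c + 1 / l ^ j})"
      using A_int by (intro emeasure_mono) (auto dest: fmeasurableD)
    then have "measure lebesgue (?T ` (A \<inter> {a..a + 1 / l ^ Suc j})) \<le>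
        measure lebesgue (A \<inter> {l * a + c..l * a + c + 1 / l ^ j})"
      using fmeasurableD2[OF A_int] unfolding measure_def by (intro enn2real_mono) (auto simp: top.not_eq_extremum)
    also have "\<dots> \<le> 1 / l ^ j * measure lebesgue (A \<inter> {0..1})" by (rule Suc)
    also have "measure lebesgue (?T ` (A \<inter> {a..a + 1 / l ^ Suc j})) = l * measure lebesgue (A \<inter> {a..a + 1 / l ^ Suc j})"
      using measure_lebesgue_affine[of l c "A \<inter> {a..a + 1 / l ^ Suc j}"] l by simp
    finally show ?case using l by (simp add: field_simps)
  qed
  have "measure lebesgue (A \<inter> {0..1}) \<in> {0, 1}"
  proof (rule measure_zero_one_low_density[OF A])
    fix \<epsilon> :: real assume "0 < \<epsilon>"
    then obtain j where "inverse \<epsilon> < l ^ j" using l real_arch_pow by blast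
    then have "1 / l ^ j < \<epsilon>" using l \<open>0 < \<epsilon>\<close> by (simp add: field_simps)
    then show "\<exists>h. 0 < h \<and> h < \<epsilon> \<and>
      (\<forall>a. measure lebesgue (A \<inter> {a..a+h}) \<le> h * measure lebesgue (A \<inter> {0..1}))"
      using density l by (intro exI[of _ "1 / l ^ j"]) auto
  qed
  also have "measure lebesgue (A \<inter> {0..1}) = measure lebesgue (limsup_balls C r \<inter> {0..1})"
  proof (rule measure_negligible_symdiff[OF A_int, symmetric])
    show "negligible (sym_diff (A \<inter> {0..1}) (limsup_balls C r \<inter> {0..1}))"
    proof (rule negligible_subset)
      show "negligible (\<Union>k. limsup_balls C (\<lambda>q. l ^ k * r q) - limsup_balls C r)"
      proof (intro negligible_countable_Union countable_image)
        fix S assume "S \<in> range (\<lambda>k. limsup_balls C (\<lambda>q. l ^ k * r q) - limsup_balls C r)"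
        then obtain k where S: "S = limsup_balls C (\<lambda>q. l ^ k * r q) - limsup_balls C r" by (rule rangeE)
        have "1 \<le> l ^ k" using l by (simp add: one_le_power)
        then show "negligible S" unfolding S by (rule negligible_limsup_balls_scale[OF r])
      qed simp
      \<comment> \<open>Level 0 is the original limsup set, so the symmetric difference consists
        only of what the scaled levels add.\<close>
      have "limsup_balls C (\<lambda>q. l ^ 0 * r q) \<subseteq> A"
        unfolding A_def by (rule UN_upper) simp
      then show "sym_diff (A \<inter> {0..1}) (limsup_balls C r \<inter> {0..1}) \<subseteq>
          (\<Union>k. limsup_balls C (\<lambda>q. l ^ k * r q) - limsup_balls C r)"
        by (auto simp: A_def)
    qed
  qed
  finally show ?thesis .
qed

lemma limsup_balls_Un:
  "limsup_balls (\<lambda>q. C q \<union> C' q) r = limsup_balls C r \<union> limsup_balls C' r"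
proof -
  have "{q. \<exists>y\<in>C q \<union> C' q. \<bar>x - y\<bar> < r q} = {q. \<exists>y\<in>C q. \<bar>x - y\<bar> < r q} \<union> {q. \<exists>y\<in>C' q. \<bar>x - y\<bar> < r q}" for x
    by auto
  then show ?thesis by (auto simp: limsup_balls_def)
qed

lemma limsup_balls_restrict_subset:
  "limsup_balls (\<lambda>q. if P q then C q else {}) r \<subseteq> limsup_balls C r"
  by (rule limsup_balls_mono) auto

lemma measure_limsup_balls_1:
  assumes "measure lebesgue (limsup_balls C r \<inter> {0..1}) = 1" "limsup_balls C r \<subseteq> limsup_balls C' r'"
  shows "measure lebesgue (limsup_balls C' r' \<inter> {0..1}) = 1"
proof -
  have m: "limsup_balls C r \<inter> {0..1} \<in> lmeasurable" for C r
    by (intro bounded_set_imp_lmeasurable) (auto intro: limsup_balls_lebesgue bounded_Int)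
  have "measure lebesgue (limsup_balls C r \<inter> {0..1}) \<le> measure lebesgue (limsup_balls C' r' \<inter> {0..1})"
    using assms(2) by (intro measure_mono_fmeasurable m fmeasurableD[OF m]) auto
  moreover have "measure lebesgue (limsup_balls C' r' \<inter> {0..1}) \<le> measure lebesgue {0..1::real}"
    by (intro measure_mono_fmeasurable fmeasurableD[OF m]) auto
  ultimately show ?thesis using assms(1) by simp
qed

subsection \<open>Reduced fractions\<close>

text \<open>The numerator ranges over all integers, so periodicity and affine invariance hold
  exactly on the line; intersection with [0, 1] is taken only when measuring.\<close>

definition reduced_fractions :: "nat \<Rightarrow> real set" where
  "reduced_fractions q = {y. 1 \<le> q \<and> (\<exists>p. gcd p (int q) = 1 \<and> y = of_int p / of_nat q)}"

text \<open>The numerator changes from \<open>p\<close> to \<open>p + s * m\<close>, which is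
  congruent to \<open>p\<close> modulo \<open>m\<close>; as \<open>l\<close> divides
  \<open>m\<close>, coprimality to \<open>m\<close> already gives coprimality to
  \<open>l * m\<close>. The case \<open>l = 1\<close> is integer periodicity.\<close>

lemma reduced_fractions_shift:
  assumes q: "q = l * m" and l: "l dvd m"
  shows "y + of_int s / of_nat l \<in> reduced_fractions q \<longleftrightarrow> y \<in> reduced_fractions q"
proof -
  have imp: "y + of_int s / of_nat l \<in> reduced_fractions q" if "y \<in> reduced_fractions q" for y s
  proof -
    from that obtain p where p: "1 \<le> q" "coprime p (int q)" "y = of_int p / of_nat q"
      by (auto simp: reduced_fractions_def coprime_iff_gcd_eq_1)
    have pm: "coprime p (int m)" using p(2) by (simp add: q)
    have cop_m: "coprime (p + s * int m) (int m)"
      using pm by (metis coprime_iff_gcd_eq_1 gcd_add_mult gcd.commute add.commute)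
    moreover have "coprime (p + s * int m) (int l)"
      using coprime_divisors[OF dvd_refl _ cop_m, of "int l"] l by simp
    ultimately have "coprime (p + s * int m) (int q)" by (simp add: q)
    moreover have "y + of_int s / of_nat l = of_int (p + s * int m) / of_nat q"
      using p(1,3) q by (simp add: field_simps)
    ultimately show ?thesis using p(1) by (auto simp: reduced_fractions_def coprime_iff_gcd_eq_1)
  qed
  show ?thesis using imp[of y s] imp[of "y + of_int s / of_nat l" "- s"] by auto
qed

lemma reduced_fractions_mult:
  assumes l: "prime l" and q: "\<not> l dvd q" and y: "y \<in> reduced_fractions q"
  shows "real l * y \<in> reduced_fractions q"
proof -
  from y obtain p where p: "1 \<le> q" "coprime p (int q)" "y = of_int p / of_nat q"
    by (auto simp: reduced_fractions_def coprime_iff_gcd_eq_1)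
  have "coprime l q" using l q by (simp add: prime_imp_coprime)
  then have "coprime (int l * p) (int q)" using p(2) by simp
  then show ?thesis using p(1,3)
    by (auto simp: reduced_fractions_def coprime_iff_gcd_eq_1 intro!: exI[of _ "int l * p"])
qed

text \<open>With q = l m the new numerator is l p + m. Multiplication by \<open>l\<close> alone
  would destroy coprimality to \<open>l\<close>; the added \<open>m\<close> restores it, and modulo
  \<open>m\<close> the numerator is still the unit l p.\<close>

lemma reduced_fractions_mult_add:
  assumes l: "prime l" and q: "l dvd q" "\<not> l\<^sup>2 dvd q" and y: "y \<in> reduced_fractions q"
  shows "real l * y + 1 / real l \<in> reduced_fractions q"
proof -
  from y obtain p where p: "1 \<le> q" "coprime p (int q)" "y = of_int p / of_nat q"
    by (auto simp: reduced_fractions_def coprime_iff_gcd_eq_1)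
  from q obtain m where m: "q = l * m" "\<not> l dvd m"
    by (auto simp: power2_eq_square dvd_def)
  have "coprime l m" using l m by (simp add: prime_imp_coprime)
  then have lm: "coprime (int l) (int m)" by simp
  have "coprime (int l * p) (int m)" using lm p(2) by (simp add: m)
  then have "coprime (int l * p + int m) (int m)"
    by (metis coprime_iff_gcd_eq_1 gcd_add1)
  moreover have "coprime (int l * p + int m) (int l)"
    using lm by (metis coprime_iff_gcd_eq_1 gcd_add_mult gcd.commute mult.commute)
  ultimately have "coprime (int l * p + int m) (int q)" by (simp add: m)
  moreover have "real l * y + 1 / real l = of_int (int l * p + int m) / of_nat q"
    using p(1,3) m by (simp add: field_simps)
  ultimately show ?thesis using p(1)
    by (auto simp: reduced_fractions_def coprime_iff_gcd_eq_1)
qed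

text \<open>If every exact prime power dividing \<open>q\<close> is at most \<open>M\<close>, then
  all prime factors lie in \<open>{..M}\<close>, and \<open>q\<close> is a product of at most
  \<open>Suc M\<close> factors of size at most \<open>M\<close>.\<close>

lemma large_exact_prime_power:
  fixes M :: nat
  obtains Q where "\<And>q. Q \<le> q \<Longrightarrow> \<exists>p k m. prime p \<and> q = p ^ k * m \<and> \<not> p dvd m \<and> M < p ^ k"
proof
  \<comment> \<open>The summand 2 excludes \<open>q = 0\<close> and also \<open>q = 1\<close>, which
    has no prime factor.\<close>
  fix q assume q: "M ^ Suc M + 2 \<le> q"
  then have q0: "q \<noteq> 0" by simp
  have "\<exists>p\<in>prime_factors q. M < p ^ multiplicity p q"
  proof (rule ccontr)
    assume "\<not> ?thesis"
    then have le: "p ^ multiplicity p q \<le> M" if "p \<in> prime_factors q" for p using that by force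
    have pf: "p \<le> M" "1 \<le> M" if "p \<in> prime_factors q" for p
    proof -
      have "p ^ 1 \<le> p ^ multiplicity p q"
        using that by (intro power_increasing) (auto simp: prime_factors_multiplicity prime_gt_0_nat Suc_le_eq)
      then show "p \<le> M" using le[OF that] by simp
      then show "1 \<le> M" using that by (metis in_prime_factors_imp_prime le_trans prime_ge_1_nat)
    qed
    have "card (prime_factors q) \<le> card {..M}" using pf by (intro card_mono) auto
    have "q = (\<Prod>p\<in>prime_factors q. p ^ multiplicity p q)"
      using q0 by (simp add: prime_factorization_nat)
    also have "\<dots> \<le> (\<Prod>p\<in>prime_factors q. M)" by (intro prod_mono) (auto intro: le)
    also have "\<dots> = M ^ card (prime_factors q)" by simp
    also have "\<dots> \<le> M ^ Suc M"
    proof (cases "prime_factors q = {}")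
      case True
      with q0 have "q = 1" by (simp add: prime_factorization_empty_iff)
      with q show ?thesis by simp
    next
      case False
      then have "1 \<le> M" using pf(2) by blast
      then show ?thesis using \<open>card (prime_factors q) \<le> card {..M}\<close>
        by (intro power_increasing) simp_all
    qed
    finally show False using q by simp
  qed
  then obtain p where p: "prime p" "M < p ^ multiplicity p q" by (auto dest: in_prime_factors_imp_prime)
  obtain m where "q = p ^ multiplicity p q * m" "\<not> p dvd m"
    using p(1) q0 multiplicity_decompose'[of q p] by (metis not_prime_unit)
  with p show "\<exists>p k m. prime p \<and> q = p ^ k * m \<and> \<not> p dvd m \<and> M < p ^ k" by blast
qed

text \<open>Write \<open>q = p ^ k * m\<close> with \<open>p ^ k\<close> large. The integers \<open>m * u + p ^ k\<close> with \<open>p\<close> not dividing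
  \<open>u\<close> are coprime to \<open>q\<close> and have gaps at most \<open>2 * m\<close>, which is small compared with \<open>q\<close>.\<close>

lemma reduced_fractions_dense:
  assumes \<epsilon>: "0 < \<epsilon>"
  obtains Q where "\<And>q x. Q \<le> q \<Longrightarrow> \<exists>y\<in>reduced_fractions q. \<bar>x - y\<bar> < \<epsilon>"
proof -
  obtain M :: nat where M: "1 / \<epsilon> < real M" using reals_Archimedean2 by blast
  obtain Q where Q: "\<And>q. Q \<le> q \<Longrightarrow> \<exists>p k m. prime p \<and> q = p ^ k * m \<and> \<not> p dvd m \<and> M < p ^ k"
    using large_exact_prime_power by blast
  have "\<exists>y\<in>reduced_fractions q. \<bar>x - y\<bar> < \<epsilon>" if "max Q 1 \<le> q" for q x
  proof -
    from that Q[of q] obtain p k m where p: "prime p" "q = p ^ k * m" "\<not> p dvd m" "M < p ^ k" by auto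
    have "m \<noteq> 0" using p(3) by (intro notI) simp
    then have m: "0 < real m" by simp
    define P where "P = int p ^ k"
    \<comment> \<open>Then \<open>x * q\<close> lies between m v + P and m (v + 1) + P, so both
      \<open>v\<close> and \<open>v + 1\<close> give a numerator within \<open>m\<close> of it; at
      least one of the two is not divisible by \<open>p\<close>.\<close>
    define v where "v = \<lfloor>(x * of_nat q - of_int P) / of_nat m\<rfloor>"
    have v: "of_int v * real m \<le> x * real q - of_int P" "x * real q - of_int P < (of_int v + 1) * real m"
      unfolding v_def using floor_divide_lower[OF m] floor_divide_upper[OF m] by auto
    have "\<not> int p dvd 1" using p(1) by (simp add: prime_nat_iff)
    then have "\<not> int p dvd v \<or> \<not> int p dvd v + 1" by (meson dvd_add_right_iff)
    then obtain u where u: "\<not> int p dvd u" "u = v \<or> u = v + 1" by blast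
    \<comment> \<open>Modulo \<open>m\<close> this is the unit \<open>P\<close>; modulo
      \<open>p\<close> it is m u, a product of two units.\<close>
    define a where "a = int m * u + P"
    have cp: "coprime (int p) (int m)" using p by (simp add: prime_imp_coprime)
    have "coprime a (int m)"
    proof -
      have "coprime P (int m)" using cp by (simp add: P_def)
      then show ?thesis unfolding a_def by (metis coprime_iff_gcd_eq_1 gcd_add_mult gcd.commute mult.commute)
    qed
    moreover have "coprime a P"
    proof -
      have "coprime (int p) u" using p(1) u(1) by (simp add: prime_imp_coprime)
      then have "coprime (int m * u) P" using cp by (simp add: P_def coprime_commute)
      then show ?thesis unfolding a_def by (metis coprime_iff_gcd_eq_1 gcd_add1)
    qed
    ultimately have "coprime a (int q)" by (simp add: p(2) P_def)
    then have "of_int a / of_nat q \<in> reduced_fractions q"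
      using that by (auto simp: reduced_fractions_def coprime_iff_gcd_eq_1)
    moreover have "\<bar>x - of_int a / of_nat q\<bar> < \<epsilon>"
    proof -
      have "\<bar>x * real q - of_int a\<bar> \<le> real m"
        using u(2) v by (auto simp: a_def algebra_simps)
      moreover have "x - of_int a / of_nat q = (x * real q - of_int a) / real q"
        using that by (simp add: diff_divide_distrib)
      ultimately have "\<bar>x - of_int a / of_nat q\<bar> \<le> real m / real q"
        by (simp add: divide_right_mono)
      also have "\<dots> = 1 / real (p ^ k)" using m by (simp add: p(2))
      also have "\<dots> < \<epsilon>"
      proof -
        have "1 / \<epsilon> < real (p ^ k)" using M p(4) by (meson less_trans of_nat_less_iff)
        moreover have "0 < real (p ^ k)" using p(4) by (simp only: of_nat_0_less_iff)
        ultimately show ?thesis using \<epsilon> by (simp only: pos_divide_less_eq mult.commute)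
      qed
      finally show ?thesis .
    qed
    ultimately show ?thesis by blast
  qed
  then show thesis by (rule that)
qed

text \<open>Covers the radii to which the scaling argument does not apply: infinitely many of them
  exceed a fixed \<epsilon>, and for large \<open>q\<close> the reduced fractions come within
  \<epsilon> of every point.\<close>

lemma limsup_balls_reduced_fractions_UNIV:
  assumes r: "\<not> r \<longlonglongrightarrow> 0" and nonneg: "\<And>q. 0 \<le> r q"
  shows "limsup_balls reduced_fractions r = UNIV"
proof -
  from r obtain \<epsilon> where \<epsilon>: "0 < \<epsilon>" "\<And>N. \<exists>q\<ge>N. \<epsilon> \<le> r q"
    using nonneg by (force simp: lim_sequentially dist_real_def not_less)
  obtain Q where Q: "\<And>q x. Q \<le> q \<Longrightarrow> \<exists>y\<in>reduced_fractions q. \<bar>x - y\<bar> < \<epsilon>"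
    using reduced_fractions_dense[OF \<epsilon>(1)] by blast
  have "infinite {q. \<exists>y\<in>reduced_fractions q. \<bar>x - y\<bar> < r q}" for x
    unfolding infinite_nat_iff_unbounded_le
  proof
    fix N
    obtain q where q: "max N Q \<le> q" "\<epsilon> \<le> r q" using \<epsilon>(2) by blast
    then obtain y where "y \<in> reduced_fractions q" "\<bar>x - y\<bar> < \<epsilon>" using Q[of q x] by auto
    with q show "\<exists>n\<ge>N. n \<in> {q. \<exists>y\<in>reduced_fractions q. \<bar>x - y\<bar> < r q}"
      by (intro exI[of _ q] conjI CollectI bexI[of _ y]) auto
  qed
  then show ?thesis by (auto simp: limsup_balls_def)
qed

text \<open>Gallagher's argument: split the denominators according to whether the exponent of \<open>l\<close>
  in \<open>q\<close> is \<open>0\<close>, \<open>1\<close> or at least \<open>2\<close>.\<close>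

lemma measure_limsup_balls_reduced_fractions:
  assumes nonneg: "\<And>q. 0 \<le> r q"
  shows "measure lebesgue (limsup_balls reduced_fractions r \<inter> {0..1}) \<in> {0, 1}"
proof (cases "r \<longlonglongrightarrow> 0")
  case False
  then show ?thesis using limsup_balls_reduced_fractions_UNIV[OF False nonneg] by simp
next
  case r: True
  let ?D = "limsup_balls reduced_fractions r"
  let ?W = "\<lambda>P. limsup_balls (\<lambda>q. if P q then reduced_fractions q else {}) r"
  have per: "y + 1 \<in> (if P q then reduced_fractions q else {}) \<longleftrightarrow>
      y \<in> (if P q then reduced_fractions q else {})" for P q y
    using reduced_fractions_shift[of q 1 q y 1] by simp
  have W_zero_one: "measure lebesgue (?W P \<inter> {0..1}) \<in> {0, 1}"
    if l: "prime l" and P: "P = (\<lambda>q. \<not> l dvd q) \<or> P = (\<lambda>q. l dvd q \<and> \<not> l\<^sup>2 dvd q)" for P and l :: nat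
  proof -
    have l1: "1 < real l" using l prime_gt_1_nat by force
    from P show ?thesis
    proof
      assume P: "P = (\<lambda>q. \<not> l dvd q)"
      show ?thesis unfolding P
        by (rule measure_limsup_balls_affine[OF r l1 per, where c = 0])
          (use reduced_fractions_mult[OF l] in \<open>simp split: if_splits\<close>)
    next
      assume P: "P = (\<lambda>q. l dvd q \<and> \<not> l\<^sup>2 dvd q)"
      show ?thesis unfolding P
        by (rule measure_limsup_balls_affine[OF r l1 per, where c = "1 / real l"])
          (use reduced_fractions_mult_add[OF l] in \<open>simp split: if_splits\<close>)
    qed
  qed
  show ?thesis
  \<comment> \<open>One full part makes the whole set full. The predicate is left arbitrary so that
    in the other case no part is full, for any prime \<open>l\<close>.\<close>
  proof (cases "\<exists>P. ?W P \<subseteq> ?D \<and> measure lebesgue (?W P \<inter> {0..1}) = 1")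
    case True
    then show ?thesis using measure_limsup_balls_1 by blast
  next
    case False
    then have not1: "measure lebesgue (?W P \<inter> {0..1}) \<noteq> 1" for P
      using limsup_balls_restrict_subset by blast
    have period: "measure lebesgue (?D \<inter> {a..a + 1 / real l}) = 1 / real l * measure lebesgue (?D \<inter> {0..1})"
      if l: "prime l" for l a
    proof -
      let ?A = "?W (\<lambda>q. \<not> l dvd q)" and ?B = "?W (\<lambda>q. l dvd q \<and> \<not> l\<^sup>2 dvd q)" and ?C = "?W (\<lambda>q. l\<^sup>2 dvd q)"
      have l0: "0 < real l" using l prime_gt_0_nat by simp
      have null: "negligible (?W P)" if "P = (\<lambda>q. \<not> l dvd q) \<or> P = (\<lambda>q. l dvd q \<and> \<not> l\<^sup>2 dvd q)" for P
        using W_zero_one[OF l that] not1[of P]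
        by (intro negligible_periodic limsup_balls_lebesgue limsup_balls_shift per) auto
      have "?A \<union> ?B \<union> ?C = limsup_balls (\<lambda>q. (if \<not> l dvd q then reduced_fractions q else {}) \<union>
          (if l dvd q \<and> \<not> l\<^sup>2 dvd q then reduced_fractions q else {}) \<union>
          (if l\<^sup>2 dvd q then reduced_fractions q else {})) r"
        by (simp only: limsup_balls_Un)
      then have cover: "?D \<subseteq> ?A \<union> ?B \<union> ?C" by (rule ssubst) (rule limsup_balls_mono, auto)
      \<comment> \<open>The first two parts are null by their zero-one law, so only the part with
        period 1/l remains.\<close>
      have C_eq: "measure lebesgue (?D \<inter> I) = measure lebesgue (?C \<inter> I)" if "I \<in> lmeasurable" for I
      proof (rule measure_negligible_symdiff)
        show "?C \<inter> I \<in> lmeasurable"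
          using that limsup_balls_lebesgue by (subst Int_commute) (rule fmeasurable_Int_fmeasurable)
        show "negligible (sym_diff (?C \<inter> I) (?D \<inter> I))"
        proof (rule negligible_subset)
          show "negligible (?A \<union> ?B)" by (intro negligible_Un null) auto
          show "sym_diff (?C \<inter> I) (?D \<inter> I) \<subseteq> ?A \<union> ?B"
            using cover limsup_balls_restrict_subset[of "\<lambda>q. l\<^sup>2 dvd q" reduced_fractions r] by blast
        qed
      qed
      have shift: "x + 1 / real l \<in> ?C \<longleftrightarrow> x \<in> ?C" for x
      proof (rule limsup_balls_shift)
        fix q y
        show "y + 1 / real l \<in> (if l\<^sup>2 dvd q then reduced_fractions q else {}) \<longleftrightarrow>
            y \<in> (if l\<^sup>2 dvd q then reduced_fractions q else {})"
        proof (cases "l\<^sup>2 dvd q")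
          case True
          then obtain m where "q = l * (l * m)" by (auto simp: power2_eq_square dvd_def mult.assoc)
          then show ?thesis using reduced_fractions_shift[of q l "l * m" y 1] True by simp
        qed simp
      qed
      \<comment> \<open>One window of length 1/l is compared with the \<open>l\<close> windows that
        make up [0, 1].\<close>
      have "measure lebesgue (?C \<inter> {a..a + 1 / real l}) = measure lebesgue (?C \<inter> {0..1 / real l})"
        using measure_periodic_interval[OF limsup_balls_lebesgue _ shift, of a 1] l0 by simp
      moreover have "measure lebesgue (?C \<inter> {0..1}) = real l * measure lebesgue (?C \<inter> {0..1 / real l})"
        using measure_periodic_interval[OF limsup_balls_lebesgue _ shift, of 0 l] l0 by simp
      moreover have "measure lebesgue (?D \<inter> {u..v}) = measure lebesgue (?C \<inter> {u..v})" for u v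
        using lmeasurable_cbox[of u v] by (intro C_eq) simp
      ultimately show ?thesis using l0 by simp
    qed
    show ?thesis
    proof (rule measure_zero_one_low_density[OF limsup_balls_lebesgue])
      fix \<epsilon> :: real assume \<epsilon>: "0 < \<epsilon>"
      obtain n :: nat where n: "1 / \<epsilon> < real n" using reals_Archimedean2 by blast
      obtain l where l: "prime l" "n < l" using bigger_prime by blast
      have "1 / \<epsilon> < real l" using n l(2) by simp
      then have "1 / real l < \<epsilon>" using \<epsilon> l(2) by (simp add: field_simps)
      then show "\<exists>h. 0 < h \<and> h < \<epsilon> \<and>
          (\<forall>a. measure lebesgue (?D \<inter> {a..a+h}) \<le> h * measure lebesgue (?D \<inter> {0..1}))"
        using l(2) period[OF l(1)] by (intro exI[of _ "1 / real l"]) simp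
    qed
  qed
qed

subsection \<open>One-dimensional fibres\<close>

definition fractions :: "nat \<Rightarrow> real set" where
  "fractions q = {y. 1 \<le> q \<and> (\<exists>p::int. y = of_int p / of_nat q)}"

text \<open>The bound forces the radii to tend to zero, and doubling sends p/q to 2p/q, so the
  affine zero-one law applies to all denominators at once.\<close>

lemma measure_limsup_balls_fractions:
  assumes "\<And>q. 0 \<le> r q" "\<And>q. r q \<le> 1 / real q"
  shows "measure lebesgue (limsup_balls fractions r \<inter> {0..1}) \<in> {0, 1}"
proof (rule measure_limsup_balls_affine[where l = 2 and c = 0])
  show "r \<longlonglongrightarrow> 0"
    by (rule tendsto_sandwich[OF _ _ tendsto_const lim_1_over_n]) (use assms in auto)
  fix q y
  have imp: "y + of_int s \<in> fractions q" if "y \<in> fractions q" for y and s :: int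
  proof -
    from that obtain p where "1 \<le> q" "y = of_int p / of_nat q" by (auto simp: fractions_def)
    then show ?thesis by (auto simp: fractions_def field_simps intro!: exI[of _ "p + s * int q"])
  qed
  show "y + 1 \<in> fractions q \<longleftrightarrow> y \<in> fractions q" using imp[of y 1] imp[of "y + 1" "-1"] by auto
  assume "y \<in> fractions q"
  then obtain p where "1 \<le> q" "y = of_int p / of_nat q" by (auto simp: fractions_def)
  then show "2 * y + 0 \<in> fractions q" by (auto simp: fractions_def intro!: exI[of _ "2 * p"])
qed simp

text \<open>For \<open>c = 0\<close> the inequality \<open>d * c < s\<close> does not involve \<open>d\<close>; the value \<open>B\<close>, which
  exceeds every admissible \<open>d\<close>, encodes that it always holds.\<close>

definition threshold :: "real \<Rightarrow> real \<Rightarrow> real \<Rightarrow> real" where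
  "threshold B c s = (if c = 0 then if s > 0 then B else 0 else min B (max 0 (s / c)))"

text \<open>Truncating s/c to [0, B] is harmless because \<open>d\<close> lies in [0, B); it yields
  nonnegative, bounded radii.\<close>

lemma threshold_iff:
  assumes "0 \<le> d" "d < B" "0 \<le> c"
  shows "d * c < s \<longleftrightarrow> d < threshold B c s"
  using assms by (auto simp: threshold_def field_simps less_max_iff_disj)

lemma threshold_bounds: "0 \<le> B \<Longrightarrow> 0 \<le> threshold B c s" "0 \<le> B \<Longrightarrow> threshold B c s \<le> B"
  by (auto simp: threshold_def)

section \<open>Distances to integers as intervals around fractions\<close>

lemma bex_fractions: "(\<exists>y\<in>fractions q. P y) \<longleftrightarrow> 1 \<le> q \<and> (\<exists>p::int. P (of_int p / of_nat q))"
  unfolding fractions_def by blast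

lemma bex_reduced_fractions:
  "(\<exists>y\<in>reduced_fractions q. P y) \<longleftrightarrow> 1 \<le> q \<and> (\<exists>p. gcd p (int q) = 1 \<and> P (of_int p / of_nat q))"
  unfolding reduced_fractions_def Bex_def by (simp only: mem_Collect_eq) metis

lemma abs_diff_fraction_less_iff:
  assumes "1 \<le> (q::nat)"
  shows "\<bar>t - of_int p / real q\<bar> < R / real q \<longleftrightarrow> \<bar>real q * t - of_int p\<bar> < R"
proof -
  have "\<bar>t - of_int p / real q\<bar> = \<bar>real q * t - of_int p\<bar> / real q"
    using assms by (simp add: field_simps abs_divide flip: abs_mult)
  then show ?thesis using assms by (simp add: divide_less_cancel)
qed

lemma dist_int_less_iff:
  assumes "1 \<le> q"
  shows "dist_int q t < R \<longleftrightarrow> (\<exists>y\<in>fractions q. \<bar>t - y\<bar> < R / real q)"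
proof -
  have "dist_int q t < R \<longleftrightarrow> (\<exists>p. \<bar>real q * t - of_int p\<bar> < R)"
    using dist_int_attained[of q t] dist_int_le[of q t] by (metis le_less_trans)
  also have "\<dots> \<longleftrightarrow> (\<exists>y\<in>fractions q. \<bar>t - y\<bar> < R / real q)"
    using assms by (simp add: bex_fractions abs_diff_fraction_less_iff)
  finally show ?thesis .
qed

lemma dist_cop_less_iff:
  assumes "1 \<le> q"
  shows "dist_cop q t < R \<longleftrightarrow> (\<exists>y\<in>reduced_fractions q. \<bar>t - y\<bar> < R / real q)"
proof -
  have "dist_cop q t < R \<longleftrightarrow> (\<exists>p. gcd p (int q) = 1 \<and> \<bar>real q * t - of_int p\<bar> < R)"
    using dist_cop_attained[of q t] dist_cop_le[of _ q t] by (metis le_less_trans)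
  also have "\<dots> \<longleftrightarrow> (\<exists>y\<in>reduced_fractions q. \<bar>t - y\<bar> < R / real q)"
    using assms by (simp add: bex_reduced_fractions abs_diff_fraction_less_iff)
  finally show ?thesis .
qed

lemma dist_int_nonneg: "0 \<le> dist_int q t"
  using dist_int_attained[of q t] by auto

lemma dist_cop_nonneg: "0 \<le> dist_cop q t"
  using dist_cop_attained[of q t] by auto

lemma dist_int_less_1: "dist_int q t < 1"
proof -
  have "\<bar>real q * t - of_int \<lfloor>real q * t\<rfloor>\<bar> < 1" by linarith
  then show ?thesis using dist_int_le[of q t "\<lfloor>real q * t\<rfloor>"] by simp
qed

text \<open>The integer 1 is coprime to every \<open>q\<close>. This crude bound serves as
  \<open>B\<close>; the resulting radii need not tend to zero.\<close>

lemma dist_cop_less_add_2: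
  assumes "t \<in> {0..1}"
  shows "dist_cop q t < real q + 2"
proof -
  have "0 \<le> real q * t" "real q * t \<le> real q" using assms by (auto simp: mult_left_le)
  then have "\<bar>real q * t - 1\<bar> < real q + 2" by (auto simp: abs_less_iff)
  then show ?thesis using dist_cop_le[of 1 q t] by simp
qed

lemma emeasure_fiber_dist_int:
  assumes c: "\<And>q. 0 \<le> c q"
  shows "emeasure lborel {t\<in>{0..1}. infinite {q. 1 \<le> q \<and> dist_int q t * c q < \<psi> q}} \<in> {0, 1}"
proof -
  \<comment> \<open>Division by \<open>q\<close> turns a bound on |q t - p| into one on |t - p/q|;
    the cap 1 gives \<open>r q\<close> \<le> 1/q.\<close>
  define r where "r q = threshold 1 (c q) (\<psi> q) / real q" for q
  have "{q. 1 \<le> q \<and> dist_int q t * c q < \<psi> q} = {q. \<exists>y\<in>fractions q. \<bar>t - y\<bar> < r q}" for t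
  proof (rule Collect_cong)
    fix q
    show "1 \<le> q \<and> dist_int q t * c q < \<psi> q \<longleftrightarrow> (\<exists>y\<in>fractions q. \<bar>t - y\<bar> < r q)"
      using threshold_iff[OF dist_int_nonneg dist_int_less_1 c] dist_int_less_iff[of q t]
      by (cases "1 \<le> q") (simp_all add: r_def bex_fractions)
  qed
  then have eq: "{t\<in>{0..1}. infinite {q. 1 \<le> q \<and> dist_int q t * c q < \<psi> q}} = limsup_balls fractions r \<inter> {0..1}"
    by (auto simp: limsup_balls_def)
  have "measure lebesgue (limsup_balls fractions r \<inter> {0..1}) \<in> {0, 1}"
    by (rule measure_limsup_balls_fractions) (auto simp: r_def threshold_bounds divide_right_mono)
  moreover have "limsup_balls fractions r \<inter> {0..1} \<in> lmeasurable"
    by (intro bounded_set_imp_lmeasurable) (auto intro: limsup_balls_lebesgue bounded_Int)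
  ultimately have "emeasure lebesgue (limsup_balls fractions r \<inter> {0..1}) \<in> {0, 1}"
    by (auto simp: emeasure_eq_measure2)
  then show ?thesis
    unfolding eq by (simp add: limsup_balls_borel)
qed

lemma emeasure_fiber_dist_cop:
  assumes c: "\<And>q. 0 \<le> c q"
  shows "emeasure lborel {t\<in>{0..1}. infinite {q. 1 \<le> q \<and> dist_cop q t * c q < \<psi> q}} \<in> {0, 1}"
proof -
  \<comment> \<open>The cap \<open>real q + 2\<close> bounds the distance only for \<open>t\<close>
    in [0, 1], so the two sets of indices are compared only there.\<close>
  define r where "r q = threshold (real q + 2) (c q) (\<psi> q) / real q" for q
  have "{q. 1 \<le> q \<and> dist_cop q t * c q < \<psi> q} = {q. \<exists>y\<in>reduced_fractions q. \<bar>t - y\<bar> < r q}"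
    if "t \<in> {0..1}" for t
  proof (rule Collect_cong)
    fix q
    show "1 \<le> q \<and> dist_cop q t * c q < \<psi> q \<longleftrightarrow> (\<exists>y\<in>reduced_fractions q. \<bar>t - y\<bar> < r q)"
      using threshold_iff[OF dist_cop_nonneg dist_cop_less_add_2[OF that] c] dist_cop_less_iff[of q t]
      by (cases "1 \<le> q") (simp_all add: r_def bex_reduced_fractions)
  qed
  then have eq: "{t\<in>{0..1}. infinite {q. 1 \<le> q \<and> dist_cop q t * c q < \<psi> q}} =
      limsup_balls reduced_fractions r \<inter> {0..1}"
    by (auto simp: limsup_balls_def)
  have "measure lebesgue (limsup_balls reduced_fractions r \<inter> {0..1}) \<in> {0, 1}"
    by (rule measure_limsup_balls_reduced_fractions) (simp add: r_def threshold_bounds)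
  moreover have "limsup_balls reduced_fractions r \<inter> {0..1} \<in> lmeasurable"
    by (intro bounded_set_imp_lmeasurable) (auto intro: limsup_balls_lebesgue bounded_Int)
  ultimately have "emeasure lebesgue (limsup_balls reduced_fractions r \<inter> {0..1}) \<in> {0, 1}"
    by (auto simp: emeasure_eq_measure2)
  then show ?thesis
    unfolding eq by (simp add: limsup_balls_borel)
qed

subsection \<open>From fibres to the cube\<close>

text \<open>Induction on the coordinates: slices orthogonal to the new coordinate are null or full
  by induction, fibres along it by hypothesis, and Fubini combines the two. Confining
  \<open>S\<close> to a power of a set of measure 1 lets the lemma apply to \<open>lborel\<close>.
  The fibre condition is imposed at every \<open>x\<close>; outside the product space the fibre is
  empty.\<close>

lemma (in sigma_finite_measure) emeasure_PiM_zero_one: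
  fixes S :: "('i \<Rightarrow> 'a) set"
  assumes "finite I" and A: "A \<in> sets M" "emeasure M A = 1"
    and "S \<in> sets (Pi\<^sub>M I (\<lambda>_. M))" "S \<subseteq> Pi\<^sub>E I (\<lambda>_. A)"
    and "\<And>i x. i \<in> I \<Longrightarrow> emeasure M {t. x(i := t) \<in> S} \<in> {0, 1}"
  shows "emeasure (Pi\<^sub>M I (\<lambda>_. M)) S \<in> {0, 1}"
proof -
  interpret product_sigma_finite "\<lambda>_. M" by unfold_locales
  show ?thesis using assms(1,4-)
  proof (induction I arbitrary: S rule: finite_induct)
    case empty
    then have "S = {} \<or> S = {\<lambda>_. undefined}" by auto
    then show ?case by (auto simp: PiM_empty)
  next
    case (insert i I)
    let ?P = "Pi\<^sub>M I (\<lambda>_. M)" and ?Q = "Pi\<^sub>M (insert i I) (\<lambda>_. M)"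
    have S[measurable]: "S \<in> sets ?Q" by (rule insert.prems)
    define f :: "('i \<Rightarrow> 'a) \<Rightarrow> 'a \<Rightarrow> ennreal" where "f x t = indicator S (x(i := t))" for x t
    \<comment> \<open>The measure of the slice of \<open>S\<close> on which coordinate
      \<open>i\<close> equals \<open>t\<close>.\<close>
    define h where "h t = (\<integral>\<^sup>+x. f x t \<partial>?P)" for t
    define m where "m = emeasure ?Q S"
    have upd: "(\<lambda>(x, t). x(i := t)) \<in> ?P \<Otimes>\<^sub>M M \<rightarrow>\<^sub>M ?Q" by (rule measurable_add_dim)
    interpret P: sigma_finite_measure ?P by (rule sigma_finite) (rule insert.hyps)
    have f[measurable]: "(\<lambda>(x, t). f x t) \<in> borel_measurable (?P \<Otimes>\<^sub>M M)"
      using measurable_compose[OF upd borel_measurable_indicator[OF S]]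
      by (simp add: f_def split_beta')
    have f_fst[measurable]: "(\<lambda>t. f x t) \<in> borel_measurable M" if "x \<in> space ?P" for x
      using measurable_Pair2[OF f that] by simp
    have f_snd[measurable]: "(\<lambda>x. f x t) \<in> borel_measurable ?P" if "t \<in> space M" for t
      using measurable_Pair1[OF f that] by simp
    have h[measurable]: "h \<in> borel_measurable M"
      unfolding h_def by (rule P.borel_measurable_nn_integral) (use measurable_compose[OF measurable_pair_swap' f] in \<open>simp add: split_beta'\<close>)
    have f_supp: "f x t = 0" if "t \<notin> A" for x t
      using insert.prems(2) that by (auto simp: f_def indicator_def PiE_iff)
    have A_space: "A \<subseteq> space M" using A(1) by (rule sets.sets_into_space)
    have f_int: "(\<integral>\<^sup>+t. f x t \<partial>M) = emeasure M {t. x(i := t) \<in> S}" "{t. x(i := t) \<in> S} \<in> sets M"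
      if "x \<in> space ?P" for x
    proof -
      have eq: "{t. x(i := t) \<in> S} = (\<lambda>t. f x t) -` {1} \<inter> space M"
        using f_supp[of _ x] A_space by (auto simp: f_def indicator_def split: if_splits)
      show *: "{t. x(i := t) \<in> S} \<in> sets M"
        unfolding eq by (rule measurable_sets[OF f_fst[OF that]]) simp
      have "f x = indicator {t. x(i := t) \<in> S}" by (auto simp: f_def indicator_def)
      then show "(\<integral>\<^sup>+t. f x t \<partial>M) = emeasure M {t. x(i := t) \<in> S}" using * by simp
    qed
    have h01: "h t \<in> {0, 1}" if t: "t \<in> space M" for t
    proof -
      let ?S = "{x \<in> space ?P. x(i := t) \<in> S}"
      have eq: "?S = (\<lambda>x. f x t) -` {1} \<inter> space ?P"
        by (auto simp: f_def indicator_def)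
      have meas: "?S \<in> sets ?P"
        unfolding eq by (rule measurable_sets[OF f_snd[OF t]]) simp
      have "emeasure ?P ?S \<in> {0, 1}"
      proof (rule insert.IH[OF meas])
        show "?S \<subseteq> Pi\<^sub>E I (\<lambda>_. A)"
        proof
          fix x assume x: "x \<in> ?S"
          then have "x(i := t) \<in> Pi\<^sub>E (insert i I) (\<lambda>_. A)" using insert.prems(2) by blast
          then have "x j \<in> A" if "j \<in> I" for j
            using that insert.hyps(2) by (auto simp: PiE_iff split: if_splits)
          then show "x \<in> Pi\<^sub>E I (\<lambda>_. A)" using x by (auto simp: space_PiM PiE_iff)
        qed
        fix j x assume j: "j \<in> I"
        have ij: "i \<noteq> j" using j insert.hyps(2) by blast
        \<comment> \<open>Says that \<open>x(j := s)\<close> belongs to the smaller product space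
          once \<open>s\<close> lies in \<open>space M\<close>. If it holds, the fibre of the slice
          is a fibre of \<open>S\<close> through \<open>x(i := t)\<close>; otherwise it is
          empty.\<close>
        let ?X = "(\<forall>k. k \<notin> I \<longrightarrow> x k = undefined) \<and> (\<forall>k\<in>I - {j}. x k \<in> space M)"
        have eq: "{s. x(j := s) \<in> ?S} = (if ?X then {s. (x(i := t))(j := s) \<in> S} else {})"
        proof -
          have S_space: "s \<in> space M" if "(x(i := t))(j := s) \<in> S" for s
          proof -
            have "(x(i := t))(j := s) \<in> Pi\<^sub>E (insert i I) (\<lambda>_. A)" using that insert.prems(2) by blast
            then have "((x(i := t))(j := s)) j \<in> A" using j by (blast intro: PiE_mem)
            then show ?thesis using A_space by auto
          qed
          have "x(j := s) \<in> space ?P \<longleftrightarrow> ?X \<and> s \<in> space M" for s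
            using j by (auto simp: space_PiM PiE_iff extensional_def)
          then show ?thesis using S_space fun_upd_twist[OF ij, of x t] by auto
        qed
        have "emeasure M {s. (x(i := t))(j := s) \<in> S} \<in> {0, 1}"
          by (rule insert.prems(3)[OF insertI2[OF j]])
        then show "emeasure M {s. x(j := s) \<in> ?S} \<in> {0, 1}"
          unfolding eq by (cases ?X) (simp_all only: if_P if_not_P emeasure_empty insertI1 simp_thms)
      qed
      moreover have "h t = emeasure ?P ?S"
      proof -
        have "h t = (\<integral>\<^sup>+x. indicator ?S x \<partial>?P)"
          unfolding h_def by (rule nn_integral_cong) (simp add: f_def indicator_def)
        then show ?thesis using meas by simp
      qed
      ultimately show ?thesis by simp
    qed
    have "m = (\<integral>\<^sup>+y. indicator S y \<partial>?Q)" by (simp add: m_def)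
    then have m1: "m = (\<integral>\<^sup>+x. (\<integral>\<^sup>+t. f x t \<partial>M) \<partial>?P)" and m2: "m = (\<integral>\<^sup>+t. h t \<partial>M)"
      using product_nn_integral_insert[OF insert.hyps, of "indicator S"]
        product_nn_integral_insert_rev[OF insert.hyps, of "indicator S"]
      by (simp_all add: f_def h_def)
    text \<open>Integrate \<open>f x t * h t\<close> in both orders: since \<open>h\<close> only takes the values 0 and 1, one
      order gives \<open>m\<close>; since each fibre in direction \<open>t\<close> is null or full, the other gives \<open>m * m\<close>.\<close>
    let ?F = "\<lambda>y. indicator S y * h (y i)"
    have F: "?F \<in> borel_measurable ?Q" by measurable
    have "(\<integral>\<^sup>+y. ?F y \<partial>?Q) = (\<integral>\<^sup>+t. (\<integral>\<^sup>+x. f x t * h t \<partial>?P) \<partial>M)"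
      using product_nn_integral_insert_rev[OF insert.hyps F] by (simp add: f_def)
    also have "\<dots> = (\<integral>\<^sup>+t. h t * h t \<partial>M)"
      by (intro nn_integral_cong) (simp add: nn_integral_multc f_snd flip: h_def)
    also have "\<dots> = (\<integral>\<^sup>+t. h t \<partial>M)"
      by (intro nn_integral_cong) (use h01 in force)
    finally have F1: "(\<integral>\<^sup>+y. ?F y \<partial>?Q) = m" by (simp add: m2)
    have "(\<integral>\<^sup>+y. ?F y \<partial>?Q) = (\<integral>\<^sup>+x. (\<integral>\<^sup>+t. f x t * h t \<partial>M) \<partial>?P)"
      using product_nn_integral_insert[OF insert.hyps F] by (simp add: f_def)
    also have "\<dots> = (\<integral>\<^sup>+x. (\<integral>\<^sup>+t. f x t \<partial>M) * m \<partial>?P)"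
    proof (rule nn_integral_cong)
      fix x assume x: "x \<in> space ?P"
      let ?T = "{t. x(i := t) \<in> S}"
      have T: "?T \<subseteq> A"
      proof
        fix t assume "t \<in> ?T"
        then have "f x t = 1" by (simp add: f_def)
        then show "t \<in> A" using f_supp by (metis zero_neq_one)
      qed
      consider "emeasure M ?T = 0" | "emeasure M ?T = 1" using insert.prems(3)[OF insertI1, of x] by blast
      then show "(\<integral>\<^sup>+t. f x t * h t \<partial>M) = (\<integral>\<^sup>+t. f x t \<partial>M) * m"
      proof cases
        case 1
        then have "AE t in M. t \<notin> ?T" using f_int(2)[OF x] by (intro AE_not_in) auto
        then have "(\<integral>\<^sup>+t. f x t * h t \<partial>M) = (\<integral>\<^sup>+t. 0 \<partial>M)"
          by (intro nn_integral_cong_AE) (auto simp: f_def)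
        then show ?thesis using 1 by (simp add: f_int(1)[OF x])
      next
        case 2
        have "A - ?T \<in> null_sets M"
          using emeasure_Diff[of M ?T A] f_int(2)[OF x] A T 2 by (auto simp: null_sets_def)
        then have "AE t in M. t \<notin> A - ?T" by (rule AE_not_in)
        then have "(\<integral>\<^sup>+t. f x t * h t \<partial>M) = (\<integral>\<^sup>+t. h t \<partial>M)"
        proof (intro nn_integral_cong_AE, elim AE_mp, intro AE_I2 impI)
          fix t assume "t \<notin> A - ?T"
          then consider "t \<notin> A" | "f x t = 1" by (auto simp: f_def)
          then show "f x t * h t = h t"
          proof cases
            case 1
            then have "h t = 0" using f_supp by (simp add: h_def)
            then show ?thesis by simp
          qed simp
        qed
        then show ?thesis using 2 by (simp add: f_int(1)[OF x] m2)
      qed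
    qed
    also have "\<dots> = m * m"
      by (subst nn_integral_multc) (simp_all add: m1[symmetric])
    finally have mm: "m = m * m" using F1 by simp
    \<comment> \<open>In the extended reals m = m * m also has the solution infinity; the bound by
      the measure of \<open>A\<close> excludes it.\<close>
    have "m \<le> (\<integral>\<^sup>+t. indicator A t \<partial>M)"
      unfolding m2
    proof (intro nn_integral_mono)
      fix t assume t: "t \<in> space M"
      show "h t \<le> indicator A t"
      proof (cases "t \<in> A")
        case True
        then show ?thesis using h01[OF t] by auto
      next
        case False
        then show ?thesis using f_supp by (simp add: h_def)
      qed
    qed
    then have "m \<le> 1" using A by simp
    then obtain r where r: "m = ennreal r" "0 \<le> r" "r \<le> 1" by (cases m) (auto simp: top_unique)
    with mm have "r = r * r" by (simp flip: ennreal_mult)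
    then have "r = 0 \<or> r = 1" by simp
    then show ?case using r by (auto simp: m_def)
  qed
qed

section \<open>Transfer from product measure to vectors\<close>

lemma sum_Basis_vec:
  fixes f :: "real ^ 'n::finite \<Rightarrow> real"
  shows "(\<Sum>b\<in>Basis. f b *\<^sub>R b) = (\<chi> j. f (axis j 1))"
proof (rule vec_eq_iff[THEN iffD2], rule allI)
  fix j
  have "(\<Sum>b\<in>Basis. f b *\<^sub>R b) \<bullet> (axis j 1 :: real ^ 'n) = f (axis j 1)"
    by (rule inner_sum_left_Basis) (auto simp: Basis_vec_def)
  then show "(\<Sum>b\<in>Basis. f b *\<^sub>R b) $ j = (\<chi> j. f (axis j 1)) $ j"
    by (simp only: cart_eq_inner_axis[symmetric] vec_lambda_beta)
qed

text \<open>Lebesgue measure on \<open>real ^ 'n\<close> is the image of the product measure indexed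
  by \<open>Basis\<close>, and the basis vectors \<open>axis i 1\<close> correspond to the
  coordinates, so fibres go over to fibres.\<close>

lemma emeasure_vec_zero_one:
  fixes S :: "(real ^ 'n::finite) set"
  assumes S: "S \<in> sets borel" and cube: "\<And>x i. x \<in> S \<Longrightarrow> x $ i \<in> {0..1}"
    and fiber: "\<And>i x. emeasure lborel {t. (\<chi> j. if j = i then t else x $ j) \<in> S} \<in> {0, 1}"
  shows "emeasure lborel S \<in> {0, 1}"
proof -
  let ?P = "Pi\<^sub>M (Basis :: (real ^ 'n) set) (\<lambda>_. lborel :: real measure)"
  let ?v = "\<lambda>f. \<Sum>b\<in>Basis. f b *\<^sub>R b :: real ^ 'n"
  let ?S = "?v -` S \<inter> space ?P"
  have v: "?v \<in> ?P \<rightarrow>\<^sub>M borel" by measurable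
  have "emeasure lborel S = emeasure ?P ?S"
    by (subst lborel_eq) (rule emeasure_distr[OF v S])
  moreover have "emeasure ?P ?S \<in> {0, 1}"
  proof (rule sigma_finite_measure.emeasure_PiM_zero_one[where A = "{0..1}"])
    show "sigma_finite_measure (lborel :: real measure)" by (rule sigma_finite_lborel)
    show "?S \<in> sets ?P" by (rule measurable_sets[OF v S])
    show "?S \<subseteq> Pi\<^sub>E Basis (\<lambda>_. {0..1})"
    proof
      fix f assume f: "f \<in> ?S"
      have "f b \<in> {0..1}" if "b \<in> Basis" for b
      proof -
        from that obtain j where "b = axis j 1" by (auto simp: Basis_vec_def)
        then show ?thesis using f cube[of "?v f" j] by (simp add: sum_Basis_vec)
      qed
      then show "f \<in> Pi\<^sub>E Basis (\<lambda>_. {0..1})" using f by (auto simp: space_PiM PiE_iff)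
    qed
    fix b :: "real ^ 'n" and f :: "real ^ 'n \<Rightarrow> real" assume b: "b \<in> Basis"
    then obtain i where i: "b = axis i 1" by (auto simp: Basis_vec_def)
    have "?v (f(b := t)) = (\<chi> j. if j = i then t else (\<chi> j. f (axis j 1)) $ j)" for t
      by (simp add: sum_Basis_vec i axis_eq_axis cong: if_cong)
    moreover have "f(b := t) \<in> space ?P \<longleftrightarrow> f \<in> extensional Basis" for t
      using b by (auto simp: space_PiM PiE_iff extensional_def)
    \<comment> \<open>A function that is not extensional on \<open>Basis\<close> lies outside the
      product space, whatever its value at \<open>b\<close>.\<close>
    ultimately have "{t. f(b := t) \<in> ?S} = (if f \<in> extensional Basis
        then {t. (\<chi> j. if j = i then t else (\<chi> j. f (axis j 1)) $ j) \<in> S} else {})"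
      by auto
    then show "emeasure lborel {t. f(b := t) \<in> ?S} \<in> {0, 1}"
      using fiber[of i "\<chi> j. f (axis j 1)"] by simp
  qed simp_all
  ultimately show ?thesis by simp
qed

text \<open>Serves both distance functions: along a coordinate line the product is
  \<open>d q t\<close> times a factor \<open>c q\<close> independent of \<open>t\<close>, which is
  the form of the one-dimensional fibre results.\<close>

lemma emeasure_limsup_set_zero_one:
  fixes d :: "nat \<Rightarrow> real \<Rightarrow> real" and \<psi> :: "nat \<Rightarrow> real"
  defines "S \<equiv> {x :: real ^ 'n::finite. (\<forall>i. x $ i \<in> {0..1}) \<and>
     infinite {q. 1 \<le> q \<and> (\<Prod>i\<in>UNIV. d q (x $ i)) < \<psi> q}}"
  assumes meas: "\<And>q. d q \<in> borel_measurable borel" and nonneg: "\<And>q t. 0 \<le> d q t"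
    and fiber: "\<And>c. (\<And>q. 0 \<le> c q) \<Longrightarrow>
      emeasure lborel {t\<in>{0..1}. infinite {q. 1 \<le> q \<and> d q t * c q < \<psi> q}} \<in> {0, 1}"
  shows "emeasure lebesgue S \<in> {0, 1}"
proof -
  have S: "S \<in> sets borel" unfolding S_def by (rule limsup_set_borel[OF meas])
  have "emeasure lborel S \<in> {0, 1}"
  proof (rule emeasure_vec_zero_one[OF S])
    show "x $ i \<in> {0..1}" if "x \<in> S" for x i using that by (simp add: S_def)
    fix i and x :: "real ^ 'n"
    define c where "c q = (\<Prod>j\<in>UNIV - {i}. d q (x $ j))" for q
    have c: "0 \<le> c q" for q unfolding c_def by (intro prod_nonneg nonneg)
    have prod: "(\<Prod>j\<in>UNIV. d q ((\<chi> j. if j = i then t else x $ j) $ j)) = d q t * c q" for q t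
      unfolding c_def by (subst prod.remove[of UNIV i]) (auto intro!: prod.cong)
    \<comment> \<open>If another coordinate lies outside [0, 1], the whole line misses
      \<open>S\<close>.\<close>
    have "{t. (\<chi> j. if j = i then t else x $ j) \<in> S} = (if \<forall>j\<in>UNIV - {i}. x $ j \<in> {0..1}
      then {t\<in>{0..1}. infinite {q. 1 \<le> q \<and> d q t * c q < \<psi> q}} else {})"
      unfolding S_def mem_Collect_eq prod by auto
    then show "emeasure lborel {t. (\<chi> j. if j = i then t else x $ j) \<in> S} \<in> {0, 1}"
      using fiber[OF c] by simp
  qed
  then show ?thesis using S by simp
qed

theorem theorem1:
  fixes \<psi> :: "nat \<Rightarrow> real"
  assumes "\<And>q. 1 \<le> q \<Longrightarrow> 0 \<le> \<psi> q"
  shows "emeasure lebesgue (S_mult \<psi> :: (real ^ 'n::finite) set) \<in> {0, 1} \<and>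
         emeasure lebesgue (D_mult \<psi> :: (real ^ 'n::finite) set) \<in> {0, 1}"
proof
  show "emeasure lebesgue (S_mult \<psi> :: (real ^ 'n) set) \<in> {0, 1}"
    unfolding S_mult_def
    by (rule emeasure_limsup_set_zero_one[where d = dist_int])
      (rule dist_int_measurable dist_int_nonneg emeasure_fiber_dist_int, assumption?)+
  show "emeasure lebesgue (D_mult \<psi> :: (real ^ 'n) set) \<in> {0, 1}"
    unfolding D_mult_def
    by (rule emeasure_limsup_set_zero_one[where d = dist_cop])
      (rule dist_cop_measurable dist_cop_nonneg emeasure_fiber_dist_cop, assumption?)+
qed

end
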